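(* For all positive integers $a,b \in \mathbb{Z}^+$, $$\gcd(a,b) \equiv - \left( x^{a+ab} \bmod \left((x^a-1)(x^b-1)\right) \right) \pmod{x}$$ in the polynomial ring $\mathbb{Z}[x]$.
   Context: Here $x$ is an indeterminate. For $f, g\in\mathbb{Z}[x]$ with $g$ monic, $f \bmod g$ denotes the remainder of $f$ on polynomial division by $g$. A congruence modulo $x$ in $\mathbb{Z}[x]$ means that the two sides differ by a multiple of $x$, i.e. have the same constant term. *)

theory Defs
  imports "HOL-Computational_Algebra.Polynomial"
begin

abbreviation X :: "int poly"
  where "X \<equiv> [:0, 1:]"

text \<open>
  The library provides \<open>mod\<close> on polynomials over a field only. For a monic divisor, division with
  remainder also works over the integers. The description below is meaningful only for
  monic \<open>g\<close>, where exactly one such \<open>r\<close> exists (see \<open>monic_rem_ex1\<close>).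
\<close>

definition is_rem :: "int poly \<Rightarrow> int poly \<Rightarrow> int poly \<Rightarrow> bool"
  where "is_rem f g r \<longleftrightarrow> (\<exists>q. f = q * g + r) \<and> (r = 0 \<or> degree r < degree g)"

definition monic_rem :: "int poly \<Rightarrow> int poly \<Rightarrow> int poly"
  where "monic_rem f g = (THE r. is_rem f g r)"

lemma is_rem_pseudo_mod:
  assumes "lead_coeff g = 1"
  shows "is_rem f g (pseudo_mod f g)"
proof -
  have "g \<noteq> 0"
    using assms by auto
  obtain q' r' where qr: "pseudo_divmod f g = (q', r')"
    by (cases "pseudo_divmod f g")
  from pseudo_divmod(1)[OF \<open>g \<noteq> 0\<close> qr] have "f = q' * g + r'"
    by (simp only: assms power_one smult_1_left mult.commute)
  then have "f = q' * g + pseudo_mod f g"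
    unfolding pseudo_mod_def qr snd_conv .
  with pseudo_mod(2)[OF \<open>g \<noteq> 0\<close>, of f] show ?thesis
    unfolding is_rem_def by blast
qed

lemma is_rem_unique:
  assumes "g \<noteq> 0" "is_rem f g r" "is_rem f g s"
  shows "r = s"
proof (rule ccontr)
  assume "r \<noteq> s"
  from assms obtain p q where "f = p * g + r" "f = q * g + s"
    unfolding is_rem_def by blast
  then have eq: "r - s = (q - p) * g"
    by (simp add: algebra_simps)
  with \<open>r \<noteq> s\<close> have "q - p \<noteq> 0"
    by auto
  with \<open>g \<noteq> 0\<close> have "degree g \<le> degree (r - s)"
    unfolding eq by (simp add: degree_mult_eq)
  moreover have "degree (r - s) < degree g"
    using assms(2,3) \<open>r \<noteq> s\<close> degree_diff_le_max[of r s] unfolding is_rem_def by auto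
  ultimately show False
    by simp
qed

lemma monic_rem_ex1:
  assumes "lead_coeff g = 1"
  shows "\<exists>!r. is_rem f g r"
  using is_rem_pseudo_mod[OF assms] is_rem_unique[of g f] assms by fastforce

lemma is_rem_monic_rem:
  assumes "lead_coeff g = 1"
  shows "is_rem f g (monic_rem f g)"
  unfolding monic_rem_def by (rule theI') (rule monic_rem_ex1[OF assms])

lemma monic_rem_eq_pseudo_mod:
  assumes "lead_coeff g = 1"
  shows "monic_rem f g = pseudo_mod f g"
  using is_rem_unique[of g f] is_rem_monic_rem[OF assms] is_rem_pseudo_mod[OF assms] assms
  by fastforce

lemma lead_coeff_X_power_minus_1:
  assumes "n > 0"
  shows "lead_coeff (X ^ n - 1) = 1"
proof -
  have "degree (1 :: int poly) < degree (X ^ n)"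
    using assms by (simp add: degree_power_eq)
  then have "lead_coeff (- 1 + X ^ n) = lead_coeff (X ^ n)"
    by (intro lead_coeff_add_le) simp
  then show ?thesis
    by (simp add: lead_coeff_power)
qed

lemma lead_coeff_divisor:
  assumes "a > 0" "b > 0"
  shows "lead_coeff ((X ^ a - 1) * (X ^ b - 1)) = 1"
  using assms by (simp only: lead_coeff_mult lead_coeff_X_power_minus_1 mult_1)

end

theory Submission
  imports Defs
begin

text \<open>
  The remainder can be written down explicitly. Let \<open>S = (\<Sum>i<b. X ^ (a * i))\<close> be the geometric sum
  with \<open>(X ^ a - 1) * S = X ^ (a * b) - 1\<close>. Then
  \<open>X ^ (a + a * b) = X ^ a + X ^ a * (X ^ a - 1) * S\<close>, and the cofactor \<open>X ^ a * S\<close> of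
  \<open>X ^ a - 1\<close> matters only modulo \<open>X ^ b - 1\<close>. There \<open>X ^ a * S\<close> agrees with \<open>S\<close>, since their
  difference \<open>X ^ (a * b) - 1\<close> is a multiple of \<open>X ^ b - 1\<close>; and \<open>S\<close> agrees with the sum \<open>T\<close>
  obtained by reducing each exponent modulo \<open>b\<close>. As \<open>T\<close> has degree below \<open>b\<close>, the polynomial
  \<open>X ^ a + (X ^ a - 1) * T\<close> has degree below \<open>a + b\<close> and is therefore the remainder
  (\<open>monic_rem_eq_folded_sum\<close>).

  Its constant term is \<open>- T(0)\<close>, and \<open>T(0)\<close> counts the \<open>i < b\<close> for which \<open>b\<close> divides \<open>a * i\<close>. These
  are the multiples of \<open>b div gcd a b\<close> below \<open>b\<close>, of which there are \<open>gcd a b\<close>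
  (\<open>card_annihilators\<close>).
\<close>

text \<open>
  Cancelling \<open>d = gcd a b\<close> leaves the coprime pair \<open>a div d\<close> and \<open>m = b div d\<close>, so the condition on
  \<open>i\<close> becomes \<open>m dvd i\<close>, and the interval below \<open>b = d * m\<close> contains \<open>d\<close> multiples of \<open>m\<close>.
\<close>

lemma card_annihilators:
  fixes a b :: nat
  assumes "b > 0"
  shows "card {i. i < b \<and> b dvd a * i} = gcd a b"
proof -
  define d where "d = gcd a b"
  define m where "m = b div d"
  have "d > 0" using assms by (simp add: d_def)
  have b: "b = d * m" by (simp add: d_def m_def)
  have a: "a = d * (a div d)" by (simp add: d_def)
  have "m > 0" using assms b by (cases m) auto
  have cop: "coprime m (a div d)"
    unfolding m_def d_def using assms
    by (simp add: div_gcd_coprime coprime_commute)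
  have dvd: "b dvd a * i \<longleftrightarrow> m dvd i" for i
  proof -
    have "b dvd a * i \<longleftrightarrow> d * m dvd d * (a div d * i)"
      using a b by (metis mult.assoc)
    also have "\<dots> \<longleftrightarrow> m dvd i"
      using \<open>d > 0\<close> cop by (simp add: coprime_dvd_mult_right_iff)
    finally show ?thesis .
  qed
  have "{i. i < b \<and> b dvd a * i} = (*) m ` {..<d}"
    using \<open>m > 0\<close> unfolding dvd by (auto simp: b mult.commute[of d] elim!: dvdE)
  moreover have "inj_on ((*) m) {..<d}"
    using \<open>m > 0\<close> by (simp add: inj_on_def)
  ultimately show ?thesis
    by (simp add: card_image d_def)
qed

lemma minus_1_dvd_power_minus_1:
  fixes x :: "'a :: comm_ring_1"
  shows "x - 1 dvd x ^ n - 1"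
  by (simp add: power_diff_1_eq)

lemma power_minus_1_dvd_fold_exponent:
  fixes x :: "'a :: comm_ring_1"
  shows "x ^ b - 1 dvd x ^ k - x ^ (k mod b)"
proof -
  have "x ^ k = (x ^ b) ^ (k div b) * x ^ (k mod b)"
    by (simp flip: power_mult power_add)
  then have "x ^ k - x ^ (k mod b) = ((x ^ b) ^ (k div b) - 1) * x ^ (k mod b)"
    by (simp add: algebra_simps)
  then show ?thesis
    by (simp add: minus_1_dvd_power_minus_1)
qed

text \<open>
  This is \<open>T\<close>, the remainder of \<open>\<Sum>i<b. X ^ (a * i)\<close> on division by \<open>X ^ b - 1\<close>.
\<close>

definition folded_sum :: "nat \<Rightarrow> nat \<Rightarrow> int poly"
  where "folded_sum a b = (\<Sum>i<b. X ^ (a * i mod b))"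

lemma degree_folded_sum_less:
  assumes "b > 0"
  shows "degree (folded_sum a b) < b"
  unfolding folded_sum_def using assms by (intro degree_sum_less) (auto simp: degree_power_eq)

lemma poly_0_folded_sum:
  assumes "b > 0"
  shows "poly (folded_sum a b) 0 = int (gcd a b)"
proof -
  have "poly (folded_sum a b) 0 = (\<Sum>i<b. if b dvd a * i then 1 else 0)"
    unfolding folded_sum_def poly_sum
    by (intro sum.cong) (auto simp: power_0_left dvd_eq_mod_eq_0)
  also have "\<dots> = int (card {i. i < b \<and> b dvd a * i})"
    by (simp add: sum.If_cases lessThan_def Int_def)
  finally show ?thesis
    using card_annihilators[OF assms] by simp
qed

lemma degree_X_power_minus_1:
  assumes "n > 0"
  shows "degree (X ^ n - 1) = n"
proof -
  have "degree (- 1 + X ^ n) = degree (X ^ n)"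
    using assms by (intro degree_add_eq_right) (simp add: degree_power_eq)
  then show ?thesis
    by (simp add: degree_power_eq)
qed

lemma monic_rem_eq_folded_sum:
  assumes "a > 0" and "b > 0"
  shows "monic_rem (X ^ (a + a * b)) ((X ^ a - 1) * (X ^ b - 1)) =
    X ^ a + (X ^ a - 1) * folded_sum a b"
    (is "monic_rem ?f ?g = ?r")
proof -
  have nz: "X ^ n - 1 \<noteq> 0" if "n > 0" for n
    using degree_X_power_minus_1[OF that] that by fastforce
  have "?g dvd ?f - ?r"
  proof -
    define S where "S = (\<Sum>i<b. X ^ (a * i))"
    have geo: "X ^ (a * b) - 1 = (X ^ a - 1) * S"
      using power_diff_1_eq[of "X ^ a" b] by (simp add: S_def power_mult)
    have "?f - ?r = X ^ a * (X ^ (a * b) - 1) - (X ^ a - 1) * folded_sum a b"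
      by (simp add: power_add algebra_simps)
    \<comment> \<open>The first summand inside the brackets is the effect of replacing \<open>X ^ a * S\<close> by \<open>S\<close>.\<close>
    also have "\<dots> = (X ^ a - 1) * ((X ^ (a * b) - 1) + (S - folded_sum a b))"
      unfolding geo by (simp add: algebra_simps)
    finally have "?f - ?r = (X ^ a - 1) * ((X ^ (a * b) - 1) + (S - folded_sum a b))" .
    moreover have "X ^ b - 1 dvd X ^ (a * b) - 1"
      using minus_1_dvd_power_minus_1[of "X ^ b" a] by (simp add: mult.commute flip: power_mult)
    moreover have "X ^ b - 1 dvd S - folded_sum a b"
      unfolding S_def folded_sum_def sum_subtractf[symmetric]
      by (intro dvd_sum power_minus_1_dvd_fold_exponent)
    ultimately show ?thesis
      by (simp only: mult_dvd_mono dvd_refl dvd_add)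
  qed
  then obtain q where "?f = q * ?g + ?r"
    by (metis diff_add_cancel dvdE mult.commute)
  moreover have "degree ?r < degree ?g"
  proof -
    have deg_g: "degree ?g = a + b"
      using assms nz by (simp add: degree_mult_eq degree_X_power_minus_1)
    have "degree ((X ^ a - 1) * folded_sum a b) < a + b"
      using degree_mult_le[of "X ^ a - 1" "folded_sum a b"] degree_folded_sum_less[OF assms(2)]
      by (simp only: degree_X_power_minus_1[OF assms(1)]) (meson add_less_cancel_left le_less_trans)
    then show ?thesis
      unfolding deg_g using assms by (intro degree_add_less) (auto simp: degree_power_eq)
  qed
  ultimately have "is_rem ?f ?g ?r"
    unfolding is_rem_def by blast
  moreover have "is_rem ?f ?g (monic_rem ?f ?g)"
    using assms by (intro is_rem_monic_rem lead_coeff_divisor)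
  moreover have "?g \<noteq> 0"
    using nz assms by simp
  ultimately show ?thesis
    using is_rem_unique by blast
qed

theorem theorem3:
  fixes a b :: nat
  assumes "a > 0" and "b > 0"
  shows "X dvd of_nat (gcd a b) - (- monic_rem (X ^ (a + a * b)) ((X ^ a - 1) * (X ^ b - 1)))"
proof -
  have "poly (of_nat (gcd a b) - (- (X ^ a + (X ^ a - 1) * folded_sum a b))) 0 = 0"
    using assms by (simp add: poly_0_folded_sum power_0_left)
  then show ?thesis
    unfolding monic_rem_eq_folded_sum[OF assms] poly_eq_0_iff_dvd by simp
qed

end
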